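(* Let $\mathcal H$ and $\mathcal G$ be Hilbert spaces, $A:\mathcal H\to\mathcal G$ a continuous linear map with adjoint $A^*$, and $f:\mathcal H\to(-\infty,+\infty]$, $g:\mathcal G\to(-\infty,+\infty]$ convex functions. All functions appearing below are assumed to be proper, closed and convex, and saddle-point solutions to all the optimization problems below are assumed to exist. Consider the problems $$\text{(P3)}\ \min_x f(x)+g(Ax),\qquad \text{(D3)}\ \min_v f^*(A^*v)+g^*(-v),$$ $$\text{(P4)}\ \min_y (f^*\circ A^* )^*(y)+g(y),\qquad \text{(D4)}\ \min_u f^*(u)+(g\circ A)^*(-u).$$ Then relaxed Peaceman–Rachford splitting (RPRS) on (P3) is equivalent to RPRS on (D4), and RPRS on (P4) is equivalent to RPRS on (D3).
   Context: Here $h^*(v)=\sup_x\{\langle v,x\rangle-h(x)\}$ denotes the convex conjugate of $h$, and $\operatorname{prox}_h(x)=\arg\min_y h(y)+\frac12\|y-x\|_2^2$ the proximal operator; $I$ is the identity map. RPRS on (P3) is the following algorithm: initialize $w^0$, $\lambda>0$, $0<\alpha\le 1$, and for $k=0,1,\dots$ set $$x^{k+1}=\operatorname{prox}_{\lambda f}(w^k),\qquad w^{k+1}=(1-\alpha)w^k+\alpha\,(2\operatorname{prox}_{\lambda\, g\circ A}-I)(2x^{k+1}-w^k).$$ RPRS on the other problems is obtained in the same way, with the pair $(f,\ g\circ A)$ replaced by the first and second terms of the respective objective: $(f^*,\ u\mapsto (g\circ A)^*(-u))$ for (D4), $((f^*\circ A^* )^*,\ g)$ for (P4), and $(f^*\circ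 A^*,\ v\mapsto g^*(-v))$ for (D3). An algorithm on one problem is said to be equivalent to another algorithm on the same or another equivalent problem if the steps in one algorithm can be recovered from the steps in the other algorithm, with proper initial conditions and parameters (so the starting points and the values of the parameters may differ between the two algorithms). *)

theory Defs
  imports "HOL-Analysis.Analysis"
begin

section \<open>Convex functions with values in the extended reals\<close>

definition epi :: "('a \<Rightarrow> ereal) \<Rightarrow> ('a \<times> real) set" where
  "epi h = {(x, r). h x \<le> ereal r}"

definition proper :: "('a \<Rightarrow> ereal) \<Rightarrow> bool" where
  "proper h \<longleftrightarrow> (\<forall>x. h x \<noteq> -\<infinity>) \<and> (\<exists>x. h x \<noteq> \<infinity>)"

definition proper_closed_convex :: "('a::real_normed_vector \<Rightarrow> ereal) \<Rightarrow> bool" where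
  "proper_closed_convex h \<longleftrightarrow> proper h \<and> closed (epi h) \<and> convex (epi h)"

definition conjugate :: "('a::real_inner \<Rightarrow> ereal) \<Rightarrow> 'a \<Rightarrow> ereal" where
  "conjugate h v = (SUP x. ereal (v \<bullet> x) - h x)"

text \<open>A minimizer picked by \<^const>\<open>arg_min\<close>; for a proper closed convex function on a
  Hilbert space the minimizer exists and is unique.\<close>

definition prox :: "('a::real_inner \<Rightarrow> ereal) \<Rightarrow> 'a \<Rightarrow> 'a" where
  "prox h x = (ARG_MIN (\<lambda>y. h y + ereal (1 / 2 * (norm (y - x))\<^sup>2)) y. True)"


section \<open>Two-term problems\<close>

text \<open>The pair \<open>(F, G)\<close> stands for the problem of minimizing \<open>F x + G x\<close> over \<open>x\<close>.\<close>

type_synonym 'a problem = "('a \<Rightarrow> ereal) \<times> ('a \<Rightarrow> ereal)"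

definition P3 :: "('h::real_inner \<Rightarrow> ereal) \<Rightarrow> ('g::real_inner \<Rightarrow> ereal) \<Rightarrow> ('h \<Rightarrow> 'g) \<Rightarrow> 'h problem" where
  "P3 f g A = (f, g \<circ> A)"

definition D3 :: "('h::real_inner \<Rightarrow> ereal) \<Rightarrow> ('g::real_inner \<Rightarrow> ereal) \<Rightarrow> ('h \<Rightarrow> 'g) \<Rightarrow> 'g problem" where
  "D3 f g A = (conjugate f \<circ> adjoint A, \<lambda>v. conjugate g (- v))"

definition P4 :: "('h::real_inner \<Rightarrow> ereal) \<Rightarrow> ('g::real_inner \<Rightarrow> ereal) \<Rightarrow> ('h \<Rightarrow> 'g) \<Rightarrow> 'g problem" where
  "P4 f g A = (conjugate (conjugate f \<circ> adjoint A), g)"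

definition D4 :: "('h::real_inner \<Rightarrow> ereal) \<Rightarrow> ('g::real_inner \<Rightarrow> ereal) \<Rightarrow> ('h \<Rightarrow> 'g) \<Rightarrow> 'h problem" where
  "D4 f g A = (conjugate f, \<lambda>u. conjugate (g \<circ> A) (- u))"

definition pcc_problem :: "'a::real_normed_vector problem \<Rightarrow> bool" where
  "pcc_problem P \<longleftrightarrow> proper_closed_convex (fst P) \<and> proper_closed_convex (snd P)"

text \<open>The Lagrangian of minimizing \<open>F x + G y\<close> subject to \<open>x = y\<close>. For \<open>F = f\<close> and
  \<open>G = g \<circ> A\<close>, a saddle point of the Lagrangian \<open>f x + g y + \<langle>v, y - A x\<rangle>\<close> induces one of
  this Lagrangian, so existence in the sense below is the weaker requirement.\<close>

definition lagrangian :: "'a::real_inner problem \<Rightarrow> 'a \<Rightarrow> 'a \<Rightarrow> 'a \<Rightarrow> ereal" where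
  "lagrangian P x y v = fst P x + snd P y + ereal (v \<bullet> (y - x))"

definition has_saddle_point :: "'a::real_inner problem \<Rightarrow> bool" where
  "has_saddle_point P \<longleftrightarrow>
    (\<exists>xs ys vs. \<forall>x y v. lagrangian P xs ys v \<le> lagrangian P xs ys vs \<and>
                         lagrangian P xs ys vs \<le> lagrangian P x y vs)"


section \<open>Relaxed Peaceman--Rachford splitting\<close>

definition scaled_prox :: "real \<Rightarrow> ('a::real_inner \<Rightarrow> ereal) \<Rightarrow> 'a \<Rightarrow> 'a" where
  "scaled_prox lam h = prox (\<lambda>x. ereal lam * h x)"

fun rprs_w :: "'a::real_inner problem \<Rightarrow> real \<times> real \<Rightarrow> 'a \<Rightarrow> nat \<Rightarrow> 'a" where
  "rprs_w P (lam, \<alpha>) w0 0 = w0"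
| "rprs_w P (lam, \<alpha>) w0 (Suc k) =
    (let w = rprs_w P (lam, \<alpha>) w0 k;
         x = scaled_prox lam (fst P) w;
         r = 2 *\<^sub>R x - w
     in (1 - \<alpha>) *\<^sub>R w + \<alpha> *\<^sub>R (2 *\<^sub>R scaled_prox lam (snd P) r - r))"

text \<open>Step \<open>k\<close> of the algorithm is the pair of \<open>w\<^sup>k\<close> and \<open>x\<^sup>k\<^sup>+\<^sup>1\<close>.\<close>

definition rprs :: "'a::real_inner problem \<Rightarrow> real \<times> real \<Rightarrow> 'a \<Rightarrow> nat \<Rightarrow> 'a \<times> 'a" where
  "rprs P p w0 k = (rprs_w P p w0 k, scaled_prox (fst p) (fst P) (rprs_w P p w0 k))"

definition rprs_params :: "(real \<times> real) set" where
  "rprs_params = {(lam, \<alpha>). 0 < lam \<and> 0 < \<alpha> \<and> \<alpha> \<le> 1}"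


section \<open>Equivalence of algorithms\<close>

text \<open>An algorithm maps parameters and an initial point to its sequence of steps. Every run of
  the first algorithm must have a companion run of the second, for suitable parameters and a
  suitable initial point, such that step \<open>k\<close> of each run is recovered from step \<open>k\<close> of the
  other. The recovery maps must not depend on the initial point or on \<open>k\<close>, and are
  required to be bounded linear: arbitrary set-theoretic maps could relate algorithms that have
  nothing to do with each other.\<close>

definition recoverable ::
  "'p set \<Rightarrow> ('p \<Rightarrow> 'i \<Rightarrow> nat \<Rightarrow> 's::real_normed_vector) \<Rightarrow>
   'q set \<Rightarrow> ('q \<Rightarrow> 'j \<Rightarrow> nat \<Rightarrow> 't::real_normed_vector) \<Rightarrow> bool" where
  "recoverable Ps a Qs b \<longleftrightarrow>
    (\<forall>p\<in>Ps. \<exists>q\<in>Qs. \<exists>R S. bounded_linear R \<and> bounded_linear S \<and>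
      (\<forall>i. \<exists>j. \<forall>k. a p i k = R (b q j k) \<and> b q j k = S (a p i k)))"

definition equivalent_algorithms ::
  "'p set \<Rightarrow> ('p \<Rightarrow> 'i \<Rightarrow> nat \<Rightarrow> 's::real_normed_vector) \<Rightarrow>
   'q set \<Rightarrow> ('q \<Rightarrow> 'j \<Rightarrow> nat \<Rightarrow> 't::real_normed_vector) \<Rightarrow> bool" where
  "equivalent_algorithms Ps a Qs b \<longleftrightarrow> recoverable Ps a Qs b \<and> recoverable Qs b Ps a"

end

theory Submission
  imports Defs
begin

text \<open>Both equivalences are Moreau's decomposition
  \<open>prox\<^bsub>\<lambda>h\<^esub> x + \<lambda> prox\<^bsub>h*/\<lambda>\<^esub> (x/\<lambda>) = x\<close> applied to each of the two proximal steps: it shows that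
  the dual iteration with parameter \<open>1/\<lambda>\<close> started at \<open>w\<^sup>0/\<lambda>\<close> is the primal one scaled
  by \<open>1/\<lambda>\<close>. The decomposition reads the same from the dual side, so for (P4) and (D3) it is used
  with \<open>f* \<circ> A*\<close> in the role of \<open>h\<close> and no biconjugation is needed. The remaining ingredient
  is that every point of a Hilbert space is \<open>p + \<lambda>q\<close> with \<open>q\<close> a subgradient of \<open>h\<close> at \<open>p\<close>,
  that is, that the proximal minimization has a solution.\<close>

section \<open>Existence of proximal points\<close>

text \<open>A ball around \<open>(x0, c - 1)\<close> misses \<open>E\<close>. A point of
  \<open>E\<close> too low for its distance from \<open>x0\<close> would, when joined to
  \<open>(x0, c)\<close>, give a segment entering that ball. The resulting cone-shaped minorant
  suffices to bound the proximal objective below.\<close>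

lemma closed_convex_epi_minorant:
  fixes E :: "('a::real_inner \<times> real) set"
  assumes "closed E" "convex E" "(x0, c) \<in> E" "(x0, c - 1) \<notin> E"
  obtains K where "K \<ge> 0" "\<And>y r. (y, r) \<in> E \<Longrightarrow> r \<ge> c - 1 - K * norm (y - x0)"
proof -
  have "open (- E)" "(x0, c - 1) \<in> - E" using assms(1,4) by auto
  then obtain e where "e > 0" "ball (x0, c - 1) e \<subseteq> - E" by (rule openE)
  then have e: "e > 0" "\<And>z. z \<in> E \<Longrightarrow> e \<le> dist (x0, c - 1) z"
    by (auto simp: subset_iff not_less[symmetric])
  have "r \<ge> c - 1 - (1 / e) * norm (y - x0)" if yr: "(y, r) \<in> E" for y r
  proof (cases "r \<le> c - 1")
    case True
    \<comment> \<open>At this \<open>t\<close> the segment from \<open>(x0, c)\<close> to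
      \<open>(y, r)\<close> crosses height \<open>c - 1\<close>.\<close>
    define t where "t = 1 / (c - r)"
    have t: "0 < t" "t \<le> 1" "t * (c - r) = 1" using True by (auto simp: t_def)
    have "(1 - t) *\<^sub>R (x0, c) + t *\<^sub>R (y, r) \<in> E"
      using assms(2,3) yr t by (intro convexD) auto
    moreover have "(1 - t) *\<^sub>R (x0, c) + t *\<^sub>R (y, r) = (x0 + t *\<^sub>R (y - x0), c - 1)"
      using t(3) by (simp add: algebra_simps)
    ultimately have "e \<le> t * norm (y - x0)"
      using e(2)[of "(x0 + t *\<^sub>R (y - x0), c - 1)"] t(1) by (simp add: dist_Pair_Pair dist_norm)
    then have "(c - r) * e \<le> (c - r) * (t * norm (y - x0))"
      using True by (intro mult_left_mono) auto
    then have "(c - r) * e \<le> norm (y - x0)"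
      using t(3) by (metis mult.commute mult.left_commute mult.right_neutral)
    then have "c - r \<le> norm (y - x0) / e" using e(1) by (simp add: pos_le_divide_eq)
    then show ?thesis by simp
  next
    case False
    moreover have "0 \<le> (1 / e) * norm (y - x0)" using e(1) by simp
    ultimately show ?thesis by linarith
  qed
  with e(1) show thesis by (intro that[of "1 / e"]) auto
qed

text \<open>Parallelogram law: the terms in \<open>r\<close> and \<open>s\<close> cancel, and only
  the quadratic part leaves a midpoint defect. This strong convexity makes minimizing sequences
  Cauchy.\<close>

lemma prox_objective_midpoint:
  fixes x y z :: "'a::real_inner"
  shows "(norm (y - z))\<^sup>2 = 8 * ((1/2) * (lam * r + 1/2 * (norm (y - x))\<^sup>2)
      + (1/2) * (lam * s + 1/2 * (norm (z - x))\<^sup>2)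
      - (lam * ((1/2) * r + (1/2) * s) + 1/2 * (norm (((1/2) *\<^sub>R y + (1/2) *\<^sub>R z) - x))\<^sup>2))"
  unfolding power2_norm_eq_inner
  by (simp add: inner_simps inner_commute algebra_simps)

text \<open>Direct method. Over pairs in \<open>E\<close> the objective is real-valued and
  continuous, so closedness of \<open>E\<close> does the work of lower semicontinuity.\<close>

lemma prox_objective_attains_min:
  fixes E :: "('a::{real_inner, complete_space} \<times> real) set"
  assumes E: "closed E" "convex E" "E \<noteq> {}" and lam: "lam > 0"
    and bound: "\<And>y r. (y, r) \<in> E \<Longrightarrow> B \<le> lam * r + 1/2 * (norm (y - x))\<^sup>2"
  obtains p a where "(p, a) \<in> E"
    "\<And>y r. (y, r) \<in> E \<Longrightarrow> lam * a + 1/2 * (norm (p - x))\<^sup>2 \<le> lam * r + 1/2 * (norm (y - x))\<^sup>2"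
proof -
  define J where "J = (\<lambda>z::'a \<times> real. lam * snd z + 1/2 * (norm (fst z - x))\<^sup>2)"
  define m where "m = Inf (J ` E)"
  have bdd: "bdd_below (J ` E)"
    using bound by (intro bdd_belowI[of _ B]) (auto simp: J_def)
  have m_le: "m \<le> J z" if "z \<in> E" for z
    unfolding m_def using bdd that by (intro cInf_lower) auto
  have "\<exists>z. z \<in> E \<and> J z < m + inverse (real (Suc n))" for n
  proof -
    have "Inf (J ` E) < m + inverse (real (Suc n))" by (simp add: m_def)
    then obtain v where "v \<in> J ` E" "v < m + inverse (real (Suc n))"
      using cInf_lessD[of "J ` E"] E(3) by (metis image_is_empty)
    then show ?thesis by auto
  qed
  then obtain z where zE: "\<And>n. z n \<in> E" and zJ: "\<And>n. J (z n) < m + inverse (real (Suc n))"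
    by metis
  have J_lim: "(\<lambda>n. J (z n)) \<longlonglongrightarrow> m"
  proof (rule tendsto_sandwich[of "\<lambda>_. m" _ _ "\<lambda>n. m + inverse (real (Suc n))"])
    show "(\<lambda>n. m + inverse (real (Suc n))) \<longlonglongrightarrow> m"
      using tendsto_add[OF tendsto_const LIMSEQ_inverse_real_of_nat] by simp
  qed (use m_le[OF zE] less_imp_le[OF zJ] in \<open>simp_all only: eventually_True tendsto_const\<close>)
  have gap: "(norm (fst (z n) - fst (z k)))\<^sup>2 \<le> 4 * ((J (z n) - m) + (J (z k) - m))" for n k
  proof -
    define u where "u = (1/2) *\<^sub>R z n + (1/2) *\<^sub>R z k"
    have "m \<le> J u"
      unfolding u_def using E(2) zE by (intro m_le convexD) auto
    moreover have "(norm (fst (z n) - fst (z k)))\<^sup>2 = 8 * ((1/2) * J (z n) + (1/2) * J (z k) - J u)"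
      using prox_objective_midpoint[of "fst (z n)" "fst (z k)" lam "snd (z n)" x "snd (z k)"]
      by (simp only: u_def J_def fst_add snd_add fst_scaleR snd_scaleR real_scaleR_def)
    ultimately show ?thesis by (simp add: algebra_simps)
  qed
  have "Cauchy (\<lambda>n. fst (z n))"
  proof (rule CauchyI)
    fix e :: real assume "e > 0"
    then have "e\<^sup>2 / 8 > 0" by simp
    then obtain N where N: "\<And>n. n \<ge> N \<Longrightarrow> norm (J (z n) - m) < e\<^sup>2 / 8"
      using J_lim by (meson LIMSEQ_D)
    have "norm (fst (z n) - fst (z k)) < e" if "n \<ge> N" "k \<ge> N" for n k
    proof (rule power2_less_imp_less)
      have "J (z n) - m < e\<^sup>2 / 8" "J (z k) - m < e\<^sup>2 / 8"
        using N[OF that(1)] N[OF that(2)] by (simp_all only: real_norm_def abs_less_iff)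
      then have "(J (z n) - m) + (J (z k) - m) < e\<^sup>2 / 8 + e\<^sup>2 / 8" by (rule add_strict_mono)
      then have "4 * ((J (z n) - m) + (J (z k) - m)) < e\<^sup>2" by simp
      with gap[of n k] show "(norm (fst (z n) - fst (z k)))\<^sup>2 < e\<^sup>2" by (rule le_less_trans)
    qed (use \<open>e > 0\<close> in simp)
    then show "\<exists>N. \<forall>n\<ge>N. \<forall>k\<ge>N. norm (fst (z n) - fst (z k)) < e" by blast
  qed
  then obtain p where p: "(\<lambda>n. fst (z n)) \<longlonglongrightarrow> p"
    using Cauchy_convergent convergent_def by blast
  \<comment> \<open>The heights \<open>snd (z n)\<close> are determined by the values of
    \<open>J\<close> and the first components, both of which converge; this is their limit.\<close>
  define a where "a = (m - 1/2 * (norm (p - x))\<^sup>2) / lam"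
  have "(\<lambda>n. (J (z n) - 1/2 * (norm (fst (z n) - x))\<^sup>2) / lam) \<longlonglongrightarrow> a"
    unfolding a_def using lam by (intro tendsto_intros J_lim p) auto
  then have "(\<lambda>n. snd (z n)) \<longlonglongrightarrow> a"
    using lam by (simp add: J_def)
  with p have "(\<lambda>n. (fst (z n), snd (z n))) \<longlonglongrightarrow> (p, a)" by (rule tendsto_Pair)
  then have "z \<longlonglongrightarrow> (p, a)" by simp
  then have "(p, a) \<in> E"
    using closed_sequentially[OF E(1)] zE by blast
  moreover have "lam * a + 1/2 * (norm (p - x))\<^sup>2 = m"
    using lam by (simp add: a_def)
  ultimately show thesis
    using m_le by (intro that[of p a]) (auto simp: J_def)
qed

text \<open>Take for \<open>p\<close> the minimizer of the proximal objective; first-order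
  optimality then makes \<open>(1 / lam) *\<^sub>R (x - p)\<close> a subgradient of \<open>h\<close>
  at \<open>p\<close>.\<close>

lemma proper_closed_convex_resolvent:
  fixes h :: "'a::{real_inner, complete_space} \<Rightarrow> ereal"
  assumes h: "proper_closed_convex h" and lam: "lam > 0"
  obtains p q a where "x = p + lam *\<^sub>R q" "h p = ereal a" "\<And>y. ereal (a + q \<bullet> (y - p)) \<le> h y"
proof -
  have cl: "closed (epi h)" and cv: "convex (epi h)" and fin: "\<And>y. h y \<noteq> -\<infinity>"
    using h by (auto simp: proper_closed_convex_def proper_def)
  obtain x0 where "h x0 \<noteq> \<infinity>" using h by (auto simp: proper_closed_convex_def proper_def)
  with fin obtain c where "h x0 = ereal c" by (cases "h x0") auto
  then have c: "(x0, c) \<in> epi h" "(x0, c - 1) \<notin> epi h" by (auto simp: epi_def)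
  obtain K where K: "K \<ge> 0" "\<And>y r. (y, r) \<in> epi h \<Longrightarrow> r \<ge> c - 1 - K * norm (y - x0)"
    using closed_convex_epi_minorant[OF cl cv c] by blast
  have bound: "lam * (c - 1 - K * norm (x - x0)) - (lam * K)\<^sup>2 / 2 \<le> lam * r + 1/2 * (norm (y - x))\<^sup>2"
    if "(y, r) \<in> epi h" for y r
  proof -
    have "norm (y - x0) \<le> norm (y - x) + norm (x - x0)"
      using norm_triangle_ineq[of "y - x" "x - x0"] by simp
    then have "K * norm (y - x0) \<le> K * (norm (y - x) + norm (x - x0))"
      using K(1) by (rule mult_left_mono)
    then have "c - 1 - K * (norm (y - x) + norm (x - x0)) \<le> r" using K(2)[OF that] by linarith
    then have "lam * (c - 1 - K * (norm (y - x) + norm (x - x0))) \<le> lam * r"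
      using lam by (intro mult_left_mono) auto
    \<comment> \<open>Completing the square in \<open>norm (y - x)\<close> absorbs the loss
      \<open>lam * K * norm (y - x)\<close> at cost \<open>(lam * K)\<^sup>2 / 2\<close>.\<close>
    moreover have "0 \<le> (norm (y - x) - lam * K)\<^sup>2" by simp
    ultimately show ?thesis by (simp add: power2_eq_square algebra_simps)
  qed
  obtain p a where pa: "(p, a) \<in> epi h"
    and min: "\<And>y r. (y, r) \<in> epi h \<Longrightarrow>
      lam * a + 1/2 * (norm (p - x))\<^sup>2 \<le> lam * r + 1/2 * (norm (y - x))\<^sup>2"
    using prox_objective_attains_min[OF cl cv _ lam bound] c(1) by blast
  define q where "q = (1 / lam) *\<^sub>R (x - p)"
  have sub: "a + q \<bullet> (y - p) \<le> r" if yr: "(y, r) \<in> epi h" for y r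
  proof -
    \<comment> \<open>\<open>D\<close> is the directional derivative of the objective at
      \<open>(p, a)\<close> towards \<open>(y, r)\<close>. The increment along the segment is
      \<open>t\<close> times the quantity in \<open>step\<close>, so letting \<open>t\<close> tend
      to 0 gives \<open>0 \<le> D\<close>.\<close>
    define D where "D = lam * (r - a) + (p - x) \<bullet> (y - p)"
    have step: "0 \<le> D + t * ((norm (y - p))\<^sup>2 / 2)" if t: "0 < t" "t \<le> 1" for t
    proof -
      have "(1 - t) *\<^sub>R (p, a) + t *\<^sub>R (y, r) \<in> epi h"
        using cv pa yr t by (intro convexD) auto
      then have "((1 - t) *\<^sub>R p + t *\<^sub>R y, (1 - t) * a + t * r) \<in> epi h" by simp
      from min[OF this] have "0 \<le> lam * ((1 - t) * a + t * r) +
          1/2 * (norm ((1 - t) *\<^sub>R p + t *\<^sub>R y - x))\<^sup>2 - (lam * a + 1/2 * (norm (p - x))\<^sup>2)" by simp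
      also have "\<dots> = t * (D + t * ((norm (y - p))\<^sup>2 / 2))"
        unfolding D_def power2_norm_eq_inner
        by (simp add: inner_simps inner_commute algebra_simps) (simp add: field_simps)
      finally show ?thesis using t(1) by (simp add: zero_le_mult_iff)
    qed
    have "((\<lambda>t. D + t * ((norm (y - p))\<^sup>2 / 2)) \<longlongrightarrow> D + 0 * ((norm (y - p))\<^sup>2 / 2)) (at_right 0)"
      by (intro tendsto_intros)
    moreover have "\<forall>\<^sub>F t::real in at_right 0. 0 < t \<and> t \<le> 1"
      unfolding eventually_at_right_field by (intro exI[of _ 1]) auto
    then have "\<forall>\<^sub>F t in at_right 0. 0 \<le> D + t * ((norm (y - p))\<^sup>2 / 2)"
      by (rule eventually_mono) (use step in auto)
    ultimately have "0 \<le> D + 0 * ((norm (y - p))\<^sup>2 / 2)"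
      by (intro tendsto_lowerbound[where F = "at_right (0::real)"]) auto
    then have "(x - p) \<bullet> (y - p) \<le> lam * (r - a)"
      by (simp add: D_def inner_simps)
    then have "q \<bullet> (y - p) \<le> r - a"
      using lam by (simp add: q_def pos_divide_le_eq mult.commute)
    then show ?thesis by simp
  qed
  have "ereal (a + q \<bullet> (y - p)) \<le> h y" for y
    using fin[of y] sub[of y] by (cases "h y") (auto simp: epi_def)
  \<comment> \<open>At \<open>y = p\<close> the inequality gives \<open>a \<le> h p\<close>;
    membership in the epigraph gives the converse.\<close>
  moreover from this[of p] pa have "h p = ereal a" by (auto simp: epi_def intro: antisym)
  moreover have "x = p + lam *\<^sub>R q" using lam by (simp add: q_def)
  ultimately show thesis using that by blast
qed

section \<open>Moreau's decomposition\<close>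

text \<open>The subgradient inequality makes the objective at \<open>y\<close> exceed its value at
  \<open>p\<close> by at least half of \<open>(norm (y - p))\<^sup>2\<close>. Hence \<open>p\<close>
  is the only minimizer and \<open>arg_min\<close> must pick it.\<close>

lemma scaled_prox_eqI:
  assumes lam: "lam > 0" and hp: "h p = ereal a"
    and sub: "\<And>y. ereal (a + q \<bullet> (y - p)) \<le> h y"
  shows "scaled_prox lam h (p + lam *\<^sub>R q) = p"
proof -
  define x where "x = p + lam *\<^sub>R q"
  define J where "J = (\<lambda>y. ereal lam * h y + ereal (1/2 * (norm (y - x))\<^sup>2))"
  have less: "J p < J y" if "y \<noteq> p" for y
  proof -
    have "lam * a + 1/2 * (norm (p - x))\<^sup>2
        = lam * (a + q \<bullet> (y - p)) + 1/2 * (norm (y - x))\<^sup>2 - 1/2 * (norm (y - p))\<^sup>2"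
      unfolding x_def power2_norm_eq_inner
      by (simp add: inner_simps inner_commute algebra_simps)
    also have "\<dots> < lam * (a + q \<bullet> (y - p)) + 1/2 * (norm (y - x))\<^sup>2" using that by simp
    finally have "J p < ereal (lam * (a + q \<bullet> (y - p)) + 1/2 * (norm (y - x))\<^sup>2)"
      by (simp add: J_def hp)
    also have "\<dots> = ereal lam * ereal (a + q \<bullet> (y - p)) + ereal (1/2 * (norm (y - x))\<^sup>2)" by simp
    also have "\<dots> \<le> J y"
      unfolding J_def using lam by (intro add_right_mono ereal_mult_left_mono sub) auto
    finally show ?thesis .
  qed
  have "is_arg_min J (\<lambda>_. True) z \<longleftrightarrow> z = p" for z
    unfolding is_arg_min_def using less by (metis less_asym less_irrefl)
  then have "arg_min J (\<lambda>_. True) = p"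
    unfolding arg_min_def by (intro some_equality) blast+
  then show ?thesis
    by (simp add: scaled_prox_def prox_def J_def x_def)
qed

lemma conjugate_ge: "ereal (v \<bullet> x) - h x \<le> conjugate h v"
  unfolding conjugate_def by (intro SUP_upper) auto

text \<open>The equality case of the Fenchel-Young inequality.\<close>

lemma conjugate_eq_if_subgradient:
  assumes hp: "h p = ereal a" and sub: "\<And>y. ereal (a + q \<bullet> (y - p)) \<le> h y"
  shows "conjugate h q = ereal (q \<bullet> p - a)"
proof (rule antisym)
  show "conjugate h q \<le> ereal (q \<bullet> p - a)"
    unfolding conjugate_def
  proof (rule SUP_least)
    fix y show "ereal (q \<bullet> y) - h y \<le> ereal (q \<bullet> p - a)"
      using sub[of y] by (cases "h y") (auto simp: inner_simps)
  qed
  show "ereal (q \<bullet> p - a) \<le> conjugate h q"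
    using conjugate_ge[of q p h] by (simp add: hp)
qed

text \<open>Moreau's identity, solved for the second prox and stated as a relation between two
  functions so that either one may be the conjugate of the other.\<close>

definition moreau_dual :: "('a::real_inner \<Rightarrow> ereal) \<Rightarrow> ('a \<Rightarrow> ereal) \<Rightarrow> bool" where
  "moreau_dual F F' \<longleftrightarrow> (\<forall>lam>0. \<forall>x.
     scaled_prox (1 / lam) F' ((1 / lam) *\<^sub>R x) = (1 / lam) *\<^sub>R (x - scaled_prox lam F x))"

text \<open>The identity at \<open>1 / lam\<close> and the rescaled point can be solved for the
  other prox.\<close>

lemma moreau_dual_sym:
  assumes "moreau_dual F F'"
  shows "moreau_dual F' F"
  unfolding moreau_dual_def
proof (intro allI impI)
  fix lam :: real and x assume lam: "lam > 0"
  define y where "y = scaled_prox (1 / lam) F ((1 / lam) *\<^sub>R x)"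
  have "scaled_prox lam F' x = lam *\<^sub>R ((1 / lam) *\<^sub>R x - y)"
    using assms[unfolded moreau_dual_def, rule_format, of "1 / lam" "(1 / lam) *\<^sub>R x"] lam
    by (simp add: y_def)
  also have "\<dots> = x - lam *\<^sub>R y" using lam by (simp add: scaleR_right_diff_distrib)
  finally have "(1 / lam) *\<^sub>R (x - scaled_prox lam F' x) = y" using lam by simp
  then show "scaled_prox (1 / lam) F ((1 / lam) *\<^sub>R x) = (1 / lam) *\<^sub>R (x - scaled_prox lam F' x)"
    by (simp add: y_def)
qed

text \<open>If \<open>q\<close> is a subgradient of \<open>h\<close> at \<open>p\<close>, then
  \<open>p\<close> is one of the conjugate at \<open>q\<close>. So one splitting of \<open>x\<close>
  computes both proximal points.\<close>

theorem moreau_decomposition: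
  fixes h :: "'a::{real_inner, complete_space} \<Rightarrow> ereal"
  assumes "proper_closed_convex h"
  shows "moreau_dual h (conjugate h)"
  unfolding moreau_dual_def
proof (intro allI impI)
  fix lam :: real and x :: 'a assume lam: "lam > 0"
  obtain p q a where x: "x = p + lam *\<^sub>R q" and hp: "h p = ereal a"
    and sub: "\<And>y. ereal (a + q \<bullet> (y - p)) \<le> h y"
    using proper_closed_convex_resolvent[OF assms lam] by metis
  have "scaled_prox lam h x = p"
    unfolding x by (rule scaled_prox_eqI[OF lam hp sub])
  moreover have "ereal ((q \<bullet> p - a) + p \<bullet> (v - q)) \<le> conjugate h v" for v
    using conjugate_ge[of v p h] by (simp add: hp inner_simps inner_commute)
  then have "scaled_prox (1 / lam) (conjugate h) (q + (1 / lam) *\<^sub>R p) = q"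
    using lam conjugate_eq_if_subgradient[OF hp sub] by (intro scaled_prox_eqI) auto
  moreover have "q + (1 / lam) *\<^sub>R p = (1 / lam) *\<^sub>R x"
    using lam by (simp add: x algebra_simps)
  ultimately show "scaled_prox (1 / lam) (conjugate h) ((1 / lam) *\<^sub>R x)
      = (1 / lam) *\<^sub>R (x - scaled_prox lam h x)"
    using lam by (simp add: x)
qed

text \<open>Uniqueness of the minimizer is needed here: \<^const>\<open>arg_min\<close> might otherwise pick
  unrelated points on the two sides.\<close>

lemma scaled_prox_reflect:
  fixes h :: "'a::{real_inner, complete_space} \<Rightarrow> ereal"
  assumes "proper_closed_convex h" "lam > 0"
  shows "scaled_prox lam (\<lambda>u. h (- u)) x = - scaled_prox lam h (- x)"
proof -
  obtain p q a where x: "- x = p + lam *\<^sub>R q" and hp: "h p = ereal a"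
    and sub: "\<And>y. ereal (a + q \<bullet> (y - p)) \<le> h y"
    using proper_closed_convex_resolvent[OF assms] by metis
  \<comment> \<open>Reflection turns the subgradient \<open>q\<close> at \<open>p\<close> into
    \<open>- q\<close> at \<open>- p\<close>.\<close>
  have "ereal (a + (- q) \<bullet> (y - (- p))) \<le> h (- y)" for y
    using sub[of "- y"] by (simp add: inner_simps)
  then have "scaled_prox lam (\<lambda>u. h (- u)) (- p + lam *\<^sub>R (- q)) = - p"
    using assms(2) hp by (intro scaled_prox_eqI) auto
  moreover have "- p + lam *\<^sub>R (- q) = x"
    using x by (metis add.inverse_inverse minus_add_distrib scaleR_minus_right)
  ultimately show ?thesis
    using scaled_prox_eqI[OF assms(2) hp sub] x by simp
qed

section \<open>Equivalence of the splitting schemes\<close>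

text \<open>A step is a pair \<open>(w, x)\<close> with \<open>x\<close> the first prox at
  \<open>w\<close>; by Moreau's identity the second component is then the dual prox at
  \<open>(1 / lam) *\<^sub>R w\<close>.\<close>

definition dual_step :: "real \<Rightarrow> 'a::real_vector \<times> 'a \<Rightarrow> 'a \<times> 'a" where
  "dual_step lam s = ((1 / lam) *\<^sub>R fst s, (1 / lam) *\<^sub>R (fst s - snd s))"

lemma bounded_linear_dual_step: "bounded_linear (dual_step lam :: 'a::real_normed_vector \<times> 'a \<Rightarrow> _)"
proof -
  have "bounded_linear (\<lambda>s::'a \<times> 'a. ((1 / lam) *\<^sub>R fst s, (1 / lam) *\<^sub>R (fst s - snd s)))"
    by (intro bounded_linear_Pair bounded_linear_const_scaleR bounded_linear_sub
        bounded_linear_fst bounded_linear_snd)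
  then show ?thesis by (simp add: dual_step_def [abs_def])
qed

lemma dual_step_inverse: "lam \<noteq> 0 \<Longrightarrow> dual_step (1 / lam) (dual_step lam s) = s"
  by (simp add: dual_step_def algebra_simps prod_eq_iff)

text \<open>The first reflected prox changes sign when passing to the dual; the argument
  \<open>- u\<close> in the second term changes it back, so the dual \<open>w\<close> stays a
  multiple of the primal one.\<close>

lemma rprs_dual:
  fixes F G F' G' :: "'a::{real_inner, complete_space} \<Rightarrow> ereal"
  assumes F: "moreau_dual F F'" and G: "moreau_dual G G'"
    and pcc: "proper_closed_convex (\<lambda>u. G' (- u))" and lam: "lam > 0"
  shows "rprs (F', \<lambda>u. G' (- u)) (1 / lam, \<alpha>) ((1 / lam) *\<^sub>R w0) k
       = dual_step lam (rprs (F, G) (lam, \<alpha>) w0 k)"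
proof -
  have F_prox: "scaled_prox (1 / lam) F' ((1 / lam) *\<^sub>R x) = (1 / lam) *\<^sub>R (x - scaled_prox lam F x)" for x
    using F lam by (simp add: moreau_dual_def)
  have G_prox: "scaled_prox (1 / lam) (\<lambda>u. G' (- u)) (- ((1 / lam) *\<^sub>R x))
      = - ((1 / lam) *\<^sub>R (x - scaled_prox lam G x))" for x
  proof -
    \<comment> \<open>The reflection lemma is applied to \<open>\<lambda>u. G' (- u)\<close>, the
      function known to be proper, closed and convex; reflecting it again gives
      \<open>G'\<close>.\<close>
    have "scaled_prox (1 / lam) G' ((1 / lam) *\<^sub>R x)
        = - scaled_prox (1 / lam) (\<lambda>u. G' (- u)) (- ((1 / lam) *\<^sub>R x))"
      using scaled_prox_reflect[OF pcc, of "1 / lam" "(1 / lam) *\<^sub>R x"] lam by simp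
    moreover have "scaled_prox (1 / lam) G' ((1 / lam) *\<^sub>R x) = (1 / lam) *\<^sub>R (x - scaled_prox lam G x)"
      using G lam by (simp add: moreau_dual_def)
    ultimately show ?thesis by (metis add.inverse_inverse)
  qed
  have w: "rprs_w (F', \<lambda>u. G' (- u)) (1 / lam, \<alpha>) ((1 / lam) *\<^sub>R w0) k
      = (1 / lam) *\<^sub>R rprs_w (F, G) (lam, \<alpha>) w0 k" for k
  proof (induction k)
    case (Suc k)
    define w where "w = rprs_w (F, G) (lam, \<alpha>) w0 k"
    define r where "r = 2 *\<^sub>R scaled_prox lam F w - w"
    have IH: "rprs_w (F', \<lambda>u. G' (- u)) (1 / lam, \<alpha>) ((1 / lam) *\<^sub>R w0) k = (1 / lam) *\<^sub>R w"
      using Suc by (simp add: w_def)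
    have r: "2 *\<^sub>R scaled_prox (1 / lam) F' ((1 / lam) *\<^sub>R w) - (1 / lam) *\<^sub>R w = - ((1 / lam) *\<^sub>R r)"
      unfolding F_prox r_def by (simp add: algebra_simps flip: scaleR_2)
    have "rprs_w (F', \<lambda>u. G' (- u)) (1 / lam, \<alpha>) ((1 / lam) *\<^sub>R w0) (Suc k)
        = (1 - \<alpha>) *\<^sub>R (1 / lam) *\<^sub>R w + \<alpha> *\<^sub>R (2 *\<^sub>R - ((1 / lam) *\<^sub>R (r - scaled_prox lam G r))
          - - ((1 / lam) *\<^sub>R r))"
      by (simp only: rprs_w.simps Let_def IH fst_conv snd_conv r G_prox)
    also have "\<dots> = (1 / lam) *\<^sub>R ((1 - \<alpha>) *\<^sub>R w + \<alpha> *\<^sub>R (2 *\<^sub>R scaled_prox lam G r - r))"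
    proof -
      have "2 *\<^sub>R - ((1 / lam) *\<^sub>R (r - scaled_prox lam G r)) - - ((1 / lam) *\<^sub>R r)
          = (1 / lam) *\<^sub>R (2 *\<^sub>R scaled_prox lam G r - r)"
        by (simp add: algebra_simps flip: scaleR_add_left)
      then show ?thesis by (simp add: scaleR_add_right mult.commute)
    qed
    also have "\<dots> = (1 / lam) *\<^sub>R rprs_w (F, G) (lam, \<alpha>) w0 (Suc k)"
      by (simp add: Let_def w_def r_def)
    finally show ?case .
  qed simp
  show ?thesis
    by (simp only: rprs_def dual_step_def w fst_conv snd_conv F_prox)
qed

text \<open>Inverting \<open>lam\<close> and keeping \<open>\<alpha>\<close> preserves the
  admissible parameters, and \<open>dual_step\<close> with \<open>lam\<close> and with
  \<open>1 / lam\<close> serve as the two recovery maps.\<close>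

lemma rprs_equivalent_dual:
  fixes F G F' G' :: "'a::{real_inner, complete_space} \<Rightarrow> ereal"
  assumes "moreau_dual F F'" "moreau_dual G G'" "proper_closed_convex (\<lambda>u. G' (- u))"
  shows "equivalent_algorithms rprs_params (rprs (F, G)) rprs_params (rprs (F', \<lambda>u. G' (- u)))"
  unfolding equivalent_algorithms_def
proof
  let ?P = "rprs (F, G)" and ?Q = "rprs (F', \<lambda>u. G' (- u))"
  have dual: "?Q (1 / lam, \<alpha>) ((1 / lam) *\<^sub>R w0) k = dual_step lam (?P (lam, \<alpha>) w0 k)"
    and primal: "?P (lam, \<alpha>) w0 k = dual_step (1 / lam) (?Q (1 / lam, \<alpha>) ((1 / lam) *\<^sub>R w0) k)"
    if "lam > 0" for lam \<alpha> w0 k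
    using rprs_dual[OF assms that] that by (simp_all add: dual_step_inverse)
  have params: "(1 / lam, \<alpha>) \<in> rprs_params" if "(lam, \<alpha>) \<in> rprs_params" for lam \<alpha>
    using that by (simp add: rprs_params_def)
  show "recoverable rprs_params ?P rprs_params ?Q"
    unfolding recoverable_def
  proof (rule ballI, clarify)
    fix lam \<alpha> :: real assume p: "(lam, \<alpha>) \<in> rprs_params"
    then have "lam > 0" by (simp add: rprs_params_def)
    with params[OF p] show "\<exists>q\<in>rprs_params. \<exists>R S. bounded_linear R \<and> bounded_linear S \<and>
        (\<forall>i. \<exists>j. \<forall>k. ?P (lam, \<alpha>) i k = R (?Q q j k) \<and> ?Q q j k = S (?P (lam, \<alpha>) i k))"
      using primal dual bounded_linear_dual_step by meson
  qed
  show "recoverable rprs_params ?Q rprs_params ?P"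
    unfolding recoverable_def
  proof (rule ballI, clarify)
    fix lam \<alpha> :: real assume p: "(lam, \<alpha>) \<in> rprs_params"
    then have lam: "lam > 0" by (simp add: rprs_params_def)
    \<comment> \<open>A dual run with \<open>lam\<close> from \<open>w0\<close> comes from the
      primal run with \<open>1 / lam\<close> from \<open>(1 / lam) *\<^sub>R w0\<close>, because the
      two rescalings cancel.\<close>
    have "?Q (lam, \<alpha>) w0 k = dual_step (1 / lam) (?P (1 / lam, \<alpha>) ((1 / lam) *\<^sub>R w0) k)"
      and "?P (1 / lam, \<alpha>) ((1 / lam) *\<^sub>R w0) k = dual_step lam (?Q (lam, \<alpha>) w0 k)" for w0 k
      using dual[of "1 / lam" \<alpha> "(1 / lam) *\<^sub>R w0" k] primal[of "1 / lam" \<alpha> "(1 / lam) *\<^sub>R w0" k] lam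
      by simp_all
    with params[OF p] show "\<exists>q\<in>rprs_params. \<exists>R S. bounded_linear R \<and> bounded_linear S \<and>
        (\<forall>i. \<exists>j. \<forall>k. ?Q (lam, \<alpha>) i k = R (?P q j k) \<and> ?P q j k = S (?Q (lam, \<alpha>) i k))"
      using bounded_linear_dual_step by meson
  qed
qed

theorem theorem4:
  fixes A :: "'h::{real_inner, complete_space} \<Rightarrow> 'g::{real_inner, complete_space}"
    and f :: "'h \<Rightarrow> ereal" and g :: "'g \<Rightarrow> ereal"
  assumes "bounded_linear A"
    and "pcc_problem (P3 f g A)" and "pcc_problem (D3 f g A)"
    and "pcc_problem (P4 f g A)" and "pcc_problem (D4 f g A)"
    and "has_saddle_point (P3 f g A)" and "has_saddle_point (D3 f g A)"
    and "has_saddle_point (P4 f g A)" and "has_saddle_point (D4 f g A)"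
  shows "equivalent_algorithms rprs_params (rprs (P3 f g A)) rprs_params (rprs (D4 f g A)) \<and>
         equivalent_algorithms rprs_params (rprs (P4 f g A)) rprs_params (rprs (D3 f g A))"
proof
  show "equivalent_algorithms rprs_params (rprs (P3 f g A)) rprs_params (rprs (D4 f g A))"
    unfolding P3_def D4_def
    by (intro rprs_equivalent_dual moreau_decomposition)
      (use assms(2,5) in \<open>simp_all only: pcc_problem_def fst_conv snd_conv P3_def D4_def \<close>)
  \<comment> \<open>Here the first term of (P4) is the conjugate of that of (D3), hence the
    symmetric form for the first pair only.\<close>
  show "equivalent_algorithms rprs_params (rprs (P4 f g A)) rprs_params (rprs (D3 f g A))"
    unfolding P4_def D3_def
    by (intro rprs_equivalent_dual moreau_decomposition moreau_dual_sym[OF moreau_decomposition])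
      (use assms(3,4) in \<open>simp_all only: pcc_problem_def fst_conv snd_conv P4_def D3_def\<close>)
qed

end
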